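(* Let $k\geq 3$ be an integer and let $D$ be a $k$-dicritical oriented graph. Then \[ m(D) \geq \left( k - \frac{3}{4}-\frac{1}{4k-6}\right) n(D) + \frac{3}{4(2k-3)}. \]
   Context: Digraphs are finite, have no loops and no parallel arcs; two opposite arcs are allowed. For a digraph $D$, $n(D)$ is its number of vertices and $m(D)$ its number of arcs. An oriented graph is a digraph with no pair of opposite arcs. A subdigraph $D'$ of $D$ satisfies $V(D')\subseteq V(D)$, $A(D')\subseteq A(D)$; it is proper if $V(D')\neq V(D)$ or $A(D')\neq A(D)$. A $k$-dicolouring of a digraph is a colouring of its vertices with colours in $\{1,\dots,k\}$ such that each colour class induces an acyclic subdigraph. The dichromatic number $\vec{\chi}(D)$ is the least $k$ such that $D$ has a $k$-dicolouring. $D$ is $k$-dicritical if $\vec{\chi}(D)=k$ and $\vec{\chi}(D')<k$ for every proper subdigraph $D'$ of $D$. *)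

theory Defs
  imports Complex_Main "Graph_Theory.Graph_Theory"
begin

locale oriented_graph = digraph +
  assumes no_opposite_arcs: "u \<rightarrow> v \<Longrightarrow> \<not> v \<rightarrow> u"

definition proper_subgraph :: "('a,'b) pre_digraph \<Rightarrow> ('a,'b) pre_digraph \<Rightarrow> bool" where
  "proper_subgraph H G \<longleftrightarrow> subgraph H G \<and> (verts H \<noteq> verts G \<or> arcs H \<noteq> arcs G)"

(* Cycles of the library are directed; a pair of opposite arcs counts as a cycle of length 2. *)
definition acyclic_digraph :: "('a,'b) pre_digraph \<Rightarrow> bool" where
  "acyclic_digraph G \<longleftrightarrow> (\<nexists>p. pre_digraph.cycle G p)"

definition dicolouring :: "('a,'b) pre_digraph \<Rightarrow> nat \<Rightarrow> ('a \<Rightarrow> nat) \<Rightarrow> bool" where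
  "dicolouring G k c \<longleftrightarrow>
     (\<forall>v\<in>verts G. c v \<in> {1..k}) \<and>
     (\<forall>i\<in>{1..k}. acyclic_digraph (G \<restriction> {v \<in> verts G. c v = i}))"

(* Only meaningful if some dicolouring exists, as is the case for every finite loopless digraph. *)
definition dichromatic_number :: "('a,'b) pre_digraph \<Rightarrow> nat" where
  "dichromatic_number G = (LEAST k. \<exists>c. dicolouring G k c)"

definition dicritical :: "nat \<Rightarrow> ('a,'b) pre_digraph \<Rightarrow> bool" where
  "dicritical k G \<longleftrightarrow>
     dichromatic_number G = k \<and>
     (\<forall>H. proper_subgraph H G \<longrightarrow> dichromatic_number H < k)"

end

theory Submission
  imports Defs
begin

text \<open>
  Put \<open>q = k - 1\<close>. Deleting a vertex \<open>v\<close> from \<open>D\<close> leaves a \<open>q\<close>-dicolourable digraph, and no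
  \<open>q\<close>-dicolouring of \<open>D - v\<close> extends to \<open>v\<close>; so every colour occurs on an out-neighbour and on an
  in-neighbour of \<open>v\<close>, and both degrees of \<open>v\<close> are at least \<open>q\<close>. Let \<open>S\<close> be the set of vertices
  whose two degrees are exactly \<open>q\<close>, and write \<open>m\<close>, \<open>n\<close>, \<open>s\<close>, \<open>t\<close> for the numbers of arcs of \<open>D\<close>,
  of vertices of \<open>D\<close>, of vertices of \<open>S\<close> and of arcs inside \<open>S\<close>. Counting degrees gives
  \<open>(2 q + 1) n \<le> 2 m + s\<close>, counting the arcs that meet \<open>S\<close> gives \<open>2 q s \<le> m + t\<close>, and together
  with \<open>2 t + 3 \<le> 3 s\<close> (for nonempty \<open>S\<close>) these inequalities yield the bound.

  The inequality \<open>2 t + 3 \<le> 3 s\<close> holds because \<open>S\<close> induces a cactus,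
  that is, a graph in which no two different cycles share an edge; each cycle of an oriented graph
  has length at least 3. It is a form of Gallai's theorem on low vertices, and is proved by moving
  a hole. Call the uncoloured vertex \<open>v\<close> of a dicolouring of \<open>D - v\<close> the
  hole. If the hole is in \<open>S\<close>, then its out-neighbours have pairwise different
  colours, and so have its in-neighbours; hence for any neighbour \<open>w\<close> of
  \<open>v\<close> one may give \<open>v\<close> the colour of \<open>w\<close> and make
  \<open>w\<close> the hole (lemma \<open>move_hole\<close>). Carrying the hole once round a
  chordless undirected cycle inside \<open>S\<close> rotates the colours on the rest of that cycle
  by one place. At each vertex of the cycle, the set of colours on its out-neighbours (or
  in-neighbours) that belong to the cycle must be the same before and after that rotation. This
  forces the cycle to be directed, with all its vertices other than the hole of one colour (lemmas \<open>fwd_x_constant\<close> and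
  \<open>colour_constant\<close>).

  Consequently, let a chordless cycle inside \<open>S\<close> begin with \<open>a, b\<close>, and
  let the hole be at \<open>a\<close>. When the hole has moved to \<open>b\<close>, the third
  vertex of the cycle is the only neighbour of \<open>b\<close>, in the direction given by the arc
  between \<open>a\<close> and \<open>b\<close>, that has the former colour of \<open>b\<close>.
  So two chordless cycles that share their first two vertices share the third. A shortest cycle
  with a chord would be split by that chord into two chordless cycles that violate this, so all
  cycles are chordless (lemma \<open>ucycle_determined_by_edge\<close>). The count in a cactus is
  by induction, removing a vertex of degree at most 1 or two adjacent vertices of degree 2; one of
  the two is always possible, as is seen at the end of a longest path (lemma
  \<open>cactus_sparse_place\<close>).
\<close>


section \<open>Cycles of an undirected graph\<close>

text \<open>
  An undirected graph is given by its adjacency relation \<open>E\<close>, which the lemmas require to be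
  symmetric and irreflexive where it matters. A cycle inside the vertex set \<open>S\<close> is the list of its
  distinct vertices in cyclic order; every rotation and reversal of the list describes the same cycle.
\<close>
definition ucycle :: "('a \<Rightarrow> 'a \<Rightarrow> bool) \<Rightarrow> 'a set \<Rightarrow> 'a list \<Rightarrow> bool" where
  "ucycle E S xs \<longleftrightarrow>
     distinct xs \<and> 3 \<le> length xs \<and> set xs \<subseteq> S \<and> successively E xs \<and> E (last xs) (hd xs)"

text \<open>
  Adjacent vertices of the list are consecutive on it, cyclically.
\<close>
definition chordless :: "('a \<Rightarrow> 'a \<Rightarrow> bool) \<Rightarrow> 'a list \<Rightarrow> bool" where
  "chordless E xs \<longleftrightarrow>
     (\<forall>s<length xs. \<forall>t<length xs. E (xs ! s) (xs ! t) \<longrightarrow>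
        s = Suc t mod length xs \<or> t = Suc s mod length xs)"

lemma ucycle_mono: "ucycle E T xs \<Longrightarrow> T \<subseteq> S \<Longrightarrow> ucycle E S xs"
  by (auto simp: ucycle_def)

lemma ucycle_swap:
  assumes "ucycle E S (xs @ ys)"
  shows "ucycle E S (ys @ xs)"
  using assms
  by (cases "xs = []"; cases "ys = []") (auto simp: ucycle_def successively_append_iff)

lemma ucycle_rev:
  assumes "symp E" "ucycle E S xs"
  shows "ucycle E S (rev xs)"
proof -
  have "successively (\<lambda>x y. E y x) xs"
    using assms by (auto simp: ucycle_def elim!: successively_mono dest: sympD)
  moreover have "xs \<noteq> []"
    using assms(2) by (auto simp: ucycle_def)
  ultimately show ?thesis
    using assms by (simp add: ucycle_def hd_rev last_rev sympD[OF assms(1)])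
qed

lemma ucycle_nth:
  assumes "ucycle E S xs"
  shows "E (xs ! (t mod length xs)) (xs ! (Suc t mod length xs))"
proof -
  let ?n = "length xs"
  have n: "?n > 0" "xs \<noteq> []" using assms by (auto simp: ucycle_def)
  show ?thesis
  proof (cases "Suc (t mod ?n) = ?n")
    case True
    then have "Suc t mod ?n = 0" "t mod ?n = ?n - 1"
      by (simp_all add: mod_Suc)
    then show ?thesis
      using assms n by (simp add: ucycle_def last_conv_nth hd_conv_nth)
  next
    case False
    then have "Suc t mod ?n = Suc (t mod ?n)" "Suc (t mod ?n) < ?n"
      using n by (simp_all add: mod_Suc Suc_lessI)
    then show ?thesis
      using assms by (simp add: ucycle_def successively_conv_nth)
  qed
qed

text \<open>
  A cycle with a chord can be read from one end \<open>a\<close> of the chord; the other end \<open>b\<close> then splits the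
  rest into two nonempty parts.
\<close>
lemma not_chordlessE:
  assumes "symp E" "irreflp E" "ucycle E S xs" "\<not> chordless E xs"
  obtains a b P Q where "ucycle E S (a # P @ b # Q)" "E a b" "P \<noteq> []" "Q \<noteq> []"
    "length (a # P @ b # Q) = length xs"
proof -
  let ?n = "length xs"
  have n: "?n \<ge> 3" using assms(3) by (simp add: ucycle_def)
  obtain s t where st: "s < ?n" "t < ?n" "E (xs ! s) (xs ! t)" "s \<noteq> Suc t mod ?n" "t \<noteq> Suc s mod ?n"
    using assms(4) by (auto simp: chordless_def)
  have "\<exists>s t. s < t \<and> t < ?n \<and> E (xs ! s) (xs ! t) \<and> s \<noteq> Suc t mod ?n \<and> t \<noteq> Suc s mod ?n"
  proof (cases s t rule: linorder_cases)
    case less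
    with st show ?thesis by blast
  next
    case equal
    with st assms(2) show ?thesis by (auto simp: irreflp_def)
  next
    case greater
    with st sympD[OF assms(1) st(3)] show ?thesis by blast
  qed
  then obtain s t where st: "s < t" "t < ?n" "E (xs ! s) (xs ! t)" "s \<noteq> Suc t mod ?n" "t \<noteq> Suc s mod ?n"
    by blast
  define A where "A = take s xs"
  define P where "P = take (t - Suc s) (drop (Suc s) xs)"
  define R where "R = drop (Suc t) xs"
  have "xs = A @ xs ! s # drop (Suc s) xs"
    using st by (simp add: A_def id_take_nth_drop)
  also have "drop (Suc s) xs = P @ drop (t - Suc s) (drop (Suc s) xs)"
    unfolding P_def by (rule append_take_drop_id[symmetric])
  also have "drop (t - Suc s) (drop (Suc s) xs) = xs ! t # R"
    using st by (simp add: R_def Cons_nth_drop_Suc)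
  finally have xs: "xs = A @ (xs ! s # P @ xs ! t # R)" by simp
  have "Suc s < ?n" using st by simp
  then have "t \<noteq> Suc s" using st(5) by auto
  then have P: "P \<noteq> []" using st by (auto simp: P_def)
  have Q: "R @ A \<noteq> []"
  proof
    assume "R @ A = []"
    then have "s = 0" "Suc t = ?n" using st by (auto simp: A_def R_def)
    then show False using st(4) by simp
  qed
  have "ucycle E S ((xs ! s # P @ xs ! t # R) @ A)"
    by (rule ucycle_swap) (use assms(3) xs in simp)
  then have "ucycle E S (xs ! s # P @ xs ! t # (R @ A))" by simp
  moreover have "length (xs ! s # P @ xs ! t # (R @ A)) = ?n"
    using arg_cong[OF xs, of length] by simp
  ultimately show ?thesis using that P Q st(3) by blast
qed

text \<open>
  If a chordless cycle is determined at its third vertex by its first two, then so is every cycle: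
  the chord \<open>a b\<close> of a shortest cycle with a chord would lie on two chordless cycles that
  leave \<open>b\<close> differently.
\<close>
lemma ucycle_determined_by_edge:
  assumes E: "symp E" "irreflp E"
    and det: "\<And>a b c d ys zs. \<lbrakk>ucycle E S (a # b # c # ys); chordless E (a # b # c # ys);
                ucycle E S (a # b # d # zs); chordless E (a # b # d # zs)\<rbrakk> \<Longrightarrow> c = d"
    and "ucycle E S (a # b # c # ys)" "ucycle E S (a # b # d # zs)"
  shows "c = d"
proof -
  have "chordless E xs" if "ucycle E S xs" for xs
    using that
  proof (induction "length xs" arbitrary: xs rule: less_induct)
    case less
    show ?case
    proof (rule ccontr)
      assume "\<not> chordless E xs"
      then obtain a b P Q where C: "ucycle E S (a # P @ b # Q)" "E a b" "P \<noteq> []" "Q \<noteq> []"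
        and len: "length (a # P @ b # Q) = length xs"
        using not_chordlessE[OF E less.prems] by metis
      obtain P' p where P: "P = P' @ [p]" using C(3) by (metis rev_exhaust)
      obtain q Q' where Q: "Q = q # Q'" using C(4) by (metis neq_Nil_conv)
      have "ucycle E S (a # P @ [b])"
      proof -
        have "successively E ((a # P @ [b]) @ Q)" using C(1) by (simp add: ucycle_def)
        then have "successively E (a # P @ [b])" by (simp only: successively_append_iff)
        then show ?thesis
          using C(1) sympD[OF E(1) C(2)] P by (auto simp: ucycle_def)
      qed
      then have "ucycle E S ((b # rev P) @ [a])"
        using ucycle_rev[OF E(1)] by fastforce
      from ucycle_swap[OF this] have 1: "ucycle E S (a # b # p # rev P')"
        by (simp add: P)
      have 2: "ucycle E S (a # b # q # Q')"
        using C Q by (auto simp: ucycle_def successively_append_iff successively_Cons)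
      have "p = q"
        using det[OF 1 _ 2] less.hyps[OF _ 1] less.hyps[OF _ 2] len P Q C(3) by auto
      then show False
        using C(1) by (simp add: ucycle_def P Q)
    qed
  qed
  then show ?thesis using det assms(4,5) by blast
qed

section \<open>Graphs in which every edge lies on at most one cycle\<close>

text \<open>
  A path inside \<open>T\<close>, as the list of its vertices; the empty list is allowed.
\<close>
definition upath :: "('a \<Rightarrow> 'a \<Rightarrow> bool) \<Rightarrow> 'a set \<Rightarrow> 'a list \<Rightarrow> bool" where
  "upath E T p \<longleftrightarrow> distinct p \<and> set p \<subseteq> T \<and> successively E p"

lemma upath_tl: "upath E T (x # p) \<Longrightarrow> upath E T p"
  by (auto simp: upath_def successively_Cons)

text \<open>
  If the end \<open>u\<close> of a path has a neighbour \<open>x\<close> further down the path, the resulting cycle can be read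
  from its second vertex backwards, or, as in the next lemma, from its third vertex backwards.
\<close>
lemma ucycle_from_path:
  assumes "symp E" "upath E T (u # v # p)" "x \<in> set p" "E u x"
  shows "\<exists>ys. ucycle E T (v # u # x # ys)"
proof -
  obtain A B where p: "p = A @ x # B" using assms(3) by (meson split_list)
  have "ucycle E T (u # v # A @ [x])"
  proof -
    have "successively E ((u # v # A @ [x]) @ B)" using assms(2) p by (simp add: upath_def)
    then have "successively E (u # v # A @ [x])" by (simp only: successively_append_iff)
    then show ?thesis
      using assms(2) sympD[OF assms(1,4)] p by (auto simp: ucycle_def upath_def)
  qed
  then have "ucycle E T ((x # rev A) @ [v, u])"
    using ucycle_rev[OF assms(1)] by fastforce
  from ucycle_swap[OF this] show ?thesis by auto
qed

lemma ucycle_from_path':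
  assumes "symp E" "upath E T (u # v # w # p)" "x \<in> set (w # p)" "E u x"
  shows "\<exists>ys. ucycle E T (w # v # u # ys)"
proof -
  obtain A B where p: "w # p = A @ x # B" using assms(3) by (meson split_list)
  then obtain ys where ys: "A @ [x] = w # ys"
    by (cases A) auto
  have p2: "w # p = w # ys @ B" using p ys by (metis append.assoc append_Cons append_Nil)
  have lx: "last (w # ys) = x" using ys by (metis last_snoc)
  have "ucycle E T (u # v # w # ys)"
    using assms(1,2,4) p2 lx
    by (auto simp: ucycle_def upath_def successively_append_iff successively_Cons dest: sympD)
  then have "ucycle E T (rev ys @ [w, v, u])"
    using ucycle_rev[OF assms(1)] by fastforce
  from ucycle_swap[OF this] show ?thesis by auto
qed

text \<open>
  In a nonempty finite graph in which any two cycles that share their first two vertices also share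
  the third, there is a vertex of degree at most 1 or a pair of adjacent vertices of degree 2.
  Otherwise consider a longest path \<open>v0, v1, v2, ...\<close>. All neighbours of \<open>v0\<close> lie on the path, and
  two of them other than \<open>v1\<close> would give two cycles through the edge \<open>v1 v0\<close>; so \<open>v0\<close> has degree 2
  and \<open>v1\<close> has a third neighbour \<open>w\<close>. Either \<open>w\<close> is on the path, or \<open>w, v1, v2, ...\<close> is again a
  longest path; in both cases there is a cycle through \<open>v2, v1, w\<close> besides the one through
  \<open>v2, v1, v0\<close>.
\<close>
lemma cactus_sparse_place:
  assumes E: "symp E" "irreflp E" and fin: "finite T" and ne: "T \<noteq> {}"
    and det: "\<And>a b c d ys zs. \<lbrakk>ucycle E T (a # b # c # ys); ucycle E T (a # b # d # zs)\<rbrakk> \<Longrightarrow> c = d"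
  shows "(\<exists>v\<in>T. card {u\<in>T. E v u} \<le> 1) \<or>
    (\<exists>v\<in>T. \<exists>w\<in>T. E v w \<and> card {u\<in>T. E v u} = 2 \<and> card {u\<in>T. E w u} = 2)"
proof (rule ccontr)
  assume neg: "\<not> ?thesis"
  let ?nb = "\<lambda>v. {u\<in>T. E v u}"
  have deg: "card (?nb v) \<ge> 2" if "v \<in> T" for v
    using neg that by force
  have other: "\<exists>x\<in>?nb v. x \<notin> F" if "finite F" "card F < card (?nb v)" for v F
    using that by (meson card_mono linorder_not_less subsetI)
  have "\<exists>p. (upath E T p \<and> p \<noteq> []) \<and> (\<forall>p'. upath E T p' \<and> p' \<noteq> [] \<longrightarrow> length p' \<le> length p)"
  proof (rule ex_has_greatest_nat[of _ _ length "card T + 1"])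
    show "upath E T [SOME v. v \<in> T] \<and> [SOME v. v \<in> T] \<noteq> []"
      using ne by (simp add: upath_def some_in_eq)
    show "\<forall>p. upath E T p \<and> p \<noteq> [] \<longrightarrow> length p < card T + 1"
      using fin by (metis card_mono distinct_card upath_def less_Suc_eq_le Suc_eq_plus1)
  qed
  then obtain p where p: "upath E T p" "p \<noteq> []"
    and max: "\<And>p'. upath E T p' \<Longrightarrow> p' \<noteq> [] \<Longrightarrow> length p' \<le> length p" by blast
  have nb_end: "?nb v \<subseteq> set p'" if "upath E T (v # p')" "length (v # p') = length p" for v p'
  proof
    fix u assume u: "u \<in> ?nb v"
    show "u \<in> set p'"
    proof (rule ccontr)
      assume "u \<notin> set p'"
      moreover have "u \<noteq> v" using u E(2) by (auto simp: irreflp_def)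
      ultimately have "upath E T (u # v # p')"
        using that(1) u E(1) by (auto simp: upath_def dest: sympD)
      then show False using max that(2) by fastforce
    qed
  qed
  obtain v0 p1 where p0: "p = v0 # p1" using p(2) by (cases p) auto
  have nb0: "?nb v0 \<subseteq> set p1" using nb_end p p0 by blast
  have v0: "v0 \<in> T" using p p0 by (auto simp: upath_def)
  have "p1 \<noteq> []"
  proof
    assume "p1 = []"
    then have "?nb v0 = {}" using nb0 by simp
    then show False using deg[OF v0] by (metis card.empty not_numeral_le_zero)
  qed
  then obtain v1 p2 where p1: "p1 = v1 # p2" by (cases p1) auto
  have path: "upath E T (v0 # v1 # p2)" using p p0 p1 by simp
  have v1: "v1 \<in> T" "E v0 v1" "E v1 v0" using path E(1) by (auto simp: upath_def dest: sympD)
  obtain x where x: "x \<in> ?nb v0" "x \<noteq> v1"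
    using other[of "{v1}" v0] deg[OF v0] by auto
  have xp: "x \<in> set p2" using x nb0 p1 by auto
  have "?nb v0 \<subseteq> {v1, x}"
  proof
    fix y assume y: "y \<in> ?nb v0"
    show "y \<in> {v1, x}"
    proof (rule ccontr)
      assume "y \<notin> {v1, x}"
      then have "y \<in> set p2" using y nb0 p1 by auto
      then obtain zs where "ucycle E T (v1 # v0 # y # zs)"
        using ucycle_from_path[OF E(1) path, of y] y by auto
      moreover obtain ys where "ucycle E T (v1 # v0 # x # ys)"
        using ucycle_from_path[OF E(1) path xp] x by auto
      ultimately have "x = y" using det by blast
      then show False using \<open>y \<notin> _\<close> by simp
    qed
  qed
  then have "card (?nb v0) \<le> card {v1, x}" by (intro card_mono) auto
  then have "card (?nb v0) = 2" using deg[OF v0] x(2) by simp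
  then have "card (?nb v1) \<noteq> 2" using neg v0 v1(1,2) by blast
  then have d1: "card (?nb v1) > 2" using deg[OF v1(1)] by linarith
  obtain v2 p3 where p2: "p2 = v2 # p3" using xp by (cases p2) auto
  obtain w where w: "w \<in> ?nb v1" "w \<notin> {v0, v2}"
  proof -
    have "card {v0, v2} \<le> 2" by (simp add: card_insert_if)
    then show ?thesis using other[of "{v0, v2}" v1] d1 that by auto
  qed
  obtain ys where c0: "ucycle E T (v2 # v1 # v0 # ys)"
    using ucycle_from_path'[OF E(1), of T v0 v1 v2 p3 x] path xp x p2 by auto
  have "\<exists>zs. ucycle E T (v2 # v1 # w # zs)"
  proof (cases "w \<in> set p3")
    case True
    have "upath E T (v1 # v2 # p3)" using path p2 by (auto dest: upath_tl)
    from ucycle_from_path[OF E(1) this True] show ?thesis using w by auto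
  next
    case False
    have "w \<noteq> v1" using w E(2) by (auto simp: irreflp_def)
    then have path': "upath E T (w # v1 # v2 # p3)"
      using path p2 w False E(1) by (auto simp: upath_def dest: sympD)
    have "?nb w \<subseteq> set (v1 # v2 # p3)" using nb_end[OF path'] p0 p1 p2 by simp
    moreover obtain y where "y \<in> ?nb w" "y \<noteq> v1"
      using other[of "{v1}" w] deg[of w] w by auto
    ultimately have "y \<in> set (v2 # p3)" "E w y" by auto
    from ucycle_from_path'[OF E(1) path' this] show ?thesis .
  qed
  then obtain zs where "ucycle E T (v2 # v1 # w # zs)" by blast
  from det[OF c0 this] w show False by simp
qed

lemma card_arcs_delete_vertex:
  assumes "finite T" "v \<in> T"
    and anti: "\<And>u w. (u, w) \<in> r \<Longrightarrow> (w, u) \<notin> r"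
  shows "card (r \<inter> T \<times> T) \<le>
    card (r \<inter> (T - {v}) \<times> (T - {v})) + card {u\<in>T. (v, u) \<in> r \<or> (u, v) \<in> r}"
proof -
  let ?N = "{u\<in>T. (v, u) \<in> r \<or> (u, v) \<in> r}"
  let ?g = "\<lambda>u. if (v, u) \<in> r then (v, u) else (u, v)"
  have "r \<inter> T \<times> T \<subseteq> (r \<inter> (T - {v}) \<times> (T - {v})) \<union> ?g ` ?N"
  proof (rule subrelI)
    fix a b assume "(a, b) \<in> r \<inter> T \<times> T"
    then have ab: "(a, b) \<in> r" "a \<in> T" "b \<in> T" by auto
    show "(a, b) \<in> (r \<inter> (T - {v}) \<times> (T - {v})) \<union> ?g ` ?N"
    proof (cases "(a, b) \<in> ?g ` ?N")
      case False
      have "a \<noteq> v"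
      proof
        assume "a = v"
        then have "b \<in> ?N" "(a, b) = ?g b" using ab by auto
        then show False using False by blast
      qed
      moreover have "b \<noteq> v"
      proof
        assume "b = v"
        then have "a \<in> ?N" "(a, b) = ?g a" using ab anti by auto
        then show False using False by blast
      qed
      ultimately show ?thesis using ab by auto
    qed simp
  qed
  then have "card (r \<inter> T \<times> T) \<le> card ((r \<inter> (T - {v}) \<times> (T - {v})) \<union> ?g ` ?N)"
    using assms(1) by (intro card_mono) auto
  also have "\<dots> \<le> card (r \<inter> (T - {v}) \<times> (T - {v})) + card (?g ` ?N)"
    by (rule card_Un_le)
  also have "card (?g ` ?N) \<le> card ?N"
    using assms(1) by (intro card_image_le) auto
  finally show ?thesis by simp
qed

text \<open>
  The bound on the number of edges of a cactus, stated for an orientation \<open>r\<close> of the graph.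
\<close>
lemma cactus_card_arcs:
  assumes "finite T" "T \<noteq> {}"
    and anti: "\<And>u w. (u, w) \<in> r \<Longrightarrow> (w, u) \<notin> r"
    and E_def: "E = (\<lambda>u v. (u, v) \<in> r \<or> (v, u) \<in> r)"
    and det: "\<And>a b c d ys zs. \<lbrakk>ucycle E T (a # b # c # ys); ucycle E T (a # b # d # zs)\<rbrakk> \<Longrightarrow> c = d"
  shows "2 * card (r \<inter> T \<times> T) + 3 \<le> 3 * card T"
  using assms(1,2) det
proof (induction "card T" arbitrary: T rule: less_induct)
  case less
  have E: "symp E" "irreflp E"
    using anti by (auto simp: E_def symp_def irreflp_def)
  have IH: "2 * card (r \<inter> T' \<times> T') + 3 \<le> 3 * card T'" if "T' \<subset> T" "T' \<noteq> {}" for T'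
  proof (rule less.hyps)
    show "card T' < card T" using that less.prems(1) by (simp add: psubset_card_mono)
    show "finite T'" using that less.prems(1) by (meson finite_subset psubset_imp_subset)
    show "T' \<noteq> {}" by fact
    fix a b c d ys zs assume "ucycle E T' (a # b # c # ys)" "ucycle E T' (a # b # d # zs)"
    then show "c = d" using less.prems(3) ucycle_mono that(1) by (metis psubset_imp_subset)
  qed
  have del: "card (r \<inter> T' \<times> T') \<le> card (r \<inter> (T' - {v}) \<times> (T' - {v})) + card {u\<in>T'. E v u}"
    if "v \<in> T'" "T' \<subseteq> T" for v T'
    using card_arcs_delete_vertex[of T' v r] that less.prems(1) anti finite_subset
    unfolding E_def by blast
  consider (low) v where "v \<in> T" "card {u\<in>T. E v u} \<le> 1"
    | (pair) v w where "v \<in> T" "w \<in> T" "E v w" "card {u\<in>T. E v u} = 2" "card {u\<in>T. E w u} = 2"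
    using cactus_sparse_place[OF E less.prems(1,2)] less.prems(3) by blast
  then show ?case
  proof cases
    case low
    have cT: "card T = Suc (card (T - {v}))"
      using less.prems(1) low(1) by (metis card.remove)
    show ?thesis
    proof (cases "T = {v}")
      case True
      then have "r \<inter> T \<times> T = {}" using anti by auto
      then show ?thesis using True by simp
    next
      case False
      then have "2 * card (r \<inter> (T - {v}) \<times> (T - {v})) + 3 \<le> 3 * card (T - {v})"
        using low(1) by (intro IH) auto
      then show ?thesis using del[OF low(1)] low(2) cT by simp
    qed
  next
    case pair
    \<comment> \<open>Removing \<open>v\<close> and \<open>w\<close> destroys three arcs only, as the arc between them counts in both degrees.\<close>
    have vw: "v \<noteq> w" using pair(3) E(2) by (auto simp: irreflp_def)
    have cT: "card T = Suc (Suc (card (T - {v} - {w})))"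
      using less.prems(1) pair(1,2) vw card.remove[of T v] card.remove[of "T - {v}" w] by simp
    have "T - {v} - {w} \<noteq> {}"
    proof
      assume "T - {v} - {w} = {}"
      then have "{u\<in>T. E v u} \<subseteq> {w}" using E(2) by (auto simp: irreflp_def)
      then have "card {u\<in>T. E v u} \<le> card {w}" by (intro card_mono) auto
      then show False using pair(4) by simp
    qed
    then have ih: "2 * card (r \<inter> (T - {v} - {w}) \<times> (T - {v} - {w})) + 3 \<le> 3 * card (T - {v} - {w})"
      using pair(1) by (intro IH) auto
    have "{u\<in>T - {v}. E w u} = {u\<in>T. E w u} - {v}" by auto
    moreover have "v \<in> {u\<in>T. E w u}" using pair(1,3) E(1) by (auto dest: sympD)
    ultimately have "card {u\<in>T - {v}. E w u} = 1" using pair(5) by simp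
    moreover have "w \<in> T - {v}" using pair(2) vw by simp
    ultimately have "card (r \<inter> T \<times> T) \<le> card (r \<inter> (T - {v} - {w}) \<times> (T - {v} - {w})) + 1 + 2"
      using del[OF pair(1)] del[of w "T - {v}"] pair(4) by fastforce
    then show ?thesis using ih cT by simp
  qed
qed

section \<open>Dicolourings and the hole\<close>

text \<open>
  The arcs of \<open>r\<close> inside \<open>A\<close> whose two ends have the same colour under \<open>\<phi>\<close>.
\<close>
definition mono_arcs :: "('a \<times> 'a) set \<Rightarrow> 'a set \<Rightarrow> ('a \<Rightarrow> nat) \<Rightarrow> ('a \<times> 'a) set" where
  "mono_arcs r A \<phi> = {(u, w) \<in> r. u \<in> A \<and> w \<in> A \<and> \<phi> u = \<phi> w}"

text \<open>
  A \<open>q\<close>-dicolouring of the digraph that the arc relation \<open>r\<close> induces on \<open>A\<close>. Since a directed walk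
  along monochromatic arcs stays inside one colour class, all the classes are acyclic if and only if
  the relation of monochromatic arcs is.
\<close>
definition dicol :: "('a \<times> 'a) set \<Rightarrow> nat \<Rightarrow> 'a set \<Rightarrow> ('a \<Rightarrow> nat) \<Rightarrow> bool" where
  "dicol r q A \<phi> \<longleftrightarrow> \<phi> ` A \<subseteq> {1..q} \<and> acyclic (mono_arcs r A \<phi>)"

lemma mono_arcs_converse: "mono_arcs (r\<inverse>) A \<phi> = (mono_arcs r A \<phi>)\<inverse>"
  by (auto simp: mono_arcs_def)

lemma dicol_converse: "dicol (r\<inverse>) q A \<phi> \<longleftrightarrow> dicol r q A \<phi>"
  by (simp add: dicol_def mono_arcs_converse)

lemma acyclic_add_sink:
  assumes "acyclic s" "s' \<subseteq> s \<union> UNIV \<times> {v}" "\<And>y. (v, y) \<notin> s'"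
  shows "acyclic s'"
proof -
  have *: "y = v \<or> (x, y) \<in> s\<^sup>+" if "(x, y) \<in> s'\<^sup>+" for x y
    using that
  proof (induction rule: trancl_induct)
    case (base y)
    then show ?case using assms(2) by auto
  next
    case (step y z)
    then have "(y, z) \<in> s \<or> z = v" "y \<noteq> v" using assms(2,3) by auto
    then show ?case using step.IH by (meson trancl_into_trancl)
  qed
  show ?thesis
    unfolding acyclic_def
  proof clarify
    fix x assume x: "(x, x) \<in> s'\<^sup>+"
    have "x \<noteq> v" using tranclD[OF x] assms(3) by blast
    then show False using * x assms(1) by (auto simp: acyclic_def)
  qed
qed

lemma dicol_colour_sink:
  assumes "dicol r q (A - {v}) \<phi>" "i \<in> {1..q}"
    and "\<And>w. w \<in> A \<Longrightarrow> (v, w) \<in> r \<Longrightarrow> w \<noteq> v \<and> \<phi> w \<noteq> i"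
  shows "dicol r q A (\<phi>(v := i))"
proof -
  have "acyclic (mono_arcs r A (\<phi>(v := i)))"
  proof (rule acyclic_add_sink)
    show "acyclic (mono_arcs r (A - {v}) \<phi>)" using assms(1) by (simp add: dicol_def)
    show "mono_arcs r A (\<phi>(v := i)) \<subseteq> mono_arcs r (A - {v}) \<phi> \<union> UNIV \<times> {v}"
      by (auto simp: mono_arcs_def split: if_splits dest: assms(3))
    show "(v, y) \<notin> mono_arcs r A (\<phi>(v := i))" for y
      by (auto simp: mono_arcs_def split: if_splits dest: assms(3))
  qed
  then show ?thesis using assms(1,2) by (auto simp: dicol_def)
qed

lemma dicol_subset: "dicol r q A \<phi> \<Longrightarrow> B \<subseteq> A \<Longrightarrow> dicol r q B \<phi>"
  unfolding dicol_def
  using acyclic_subset[of "mono_arcs r A \<phi>" "mono_arcs r B \<phi>"] by (auto simp: mono_arcs_def)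

text \<open>
  What is used of a \<open>(q + 1)\<close>-dicritical oriented graph: it has no \<open>q\<close>-dicolouring, but
  acquires one when any vertex is deleted. The assumption on opposite arcs excludes loops, too. The
  situation is symmetric under reversal of all arcs, so that statements about in-neighbours follow
  from those about out-neighbours.
\<close>
locale critical_oriented =
  fixes r :: "('a \<times> 'a) set" and V :: "'a set" and q :: nat
  assumes finite_V: "finite V"
    and arcs_V: "r \<subseteq> V \<times> V"
    and antisym: "(u, v) \<in> r \<Longrightarrow> (v, u) \<notin> r"
    and col_delete: "v \<in> V \<Longrightarrow> \<exists>\<phi>. dicol r q (V - {v}) \<phi>"
    and no_col: "\<not> dicol r q V \<phi>"
begin

lemma converse_critical: "critical_oriented (r\<inverse>) V q"
  using finite_V arcs_V antisym col_delete no_col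
  by unfold_locales (auto simp: dicol_converse)

lemma irrefl: "(v, v) \<notin> r"
  using antisym by blast

lemma finite_r: "finite r"
  using arcs_V finite_V by (meson finite_SigmaI finite_subset)

lemma finite_out: "finite (r `` {v})"
  using finite_r by (simp add: finite_Image)

lemma out_colours:
  assumes "v \<in> V" "dicol r q (V - {v}) \<phi>"
  shows "{1..q} \<subseteq> \<phi> ` (r `` {v})"
proof
  fix i assume i: "i \<in> {1..q}"
  show "i \<in> \<phi> ` (r `` {v})"
  proof (rule ccontr)
    assume "i \<notin> \<phi> ` (r `` {v})"
    then have "dicol r q V (\<phi>(v := i))"
      using irrefl by (intro dicol_colour_sink assms(2) i) auto
    then show False using no_col by blast
  qed
qed

lemma out_degree_ge:
  assumes "v \<in> V"
  shows "card (r `` {v}) \<ge> q"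
proof -
  obtain \<phi> where "dicol r q (V - {v}) \<phi>" using col_delete assms by blast
  then have "card {1..q} \<le> card (\<phi> ` (r `` {v}))"
    using out_colours assms finite_out by (intro card_mono) auto
  also have "\<dots> \<le> card (r `` {v})" using finite_out by (rule card_image_le)
  finally show ?thesis by simp
qed

lemma in_degree_ge: "v \<in> V \<Longrightarrow> card (r\<inverse> `` {v}) \<ge> q"
  using critical_oriented.out_degree_ge[OF converse_critical] by simp

text \<open>
  The vertices whose out-degree and in-degree both take the least possible value \<open>q\<close>.
\<close>
definition S :: "'a set" where
  "S = {v\<in>V. card (r `` {v}) = q \<and> card (r\<inverse> `` {v}) = q}"

lemma S_converse: "critical_oriented.S (r\<inverse>) V q = S"
  unfolding S_def critical_oriented.S_def[OF converse_critical] by auto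

lemma out_bij:
  assumes "v \<in> S" "dicol r q (V - {v}) \<phi>"
  shows "inj_on \<phi> (r `` {v})" "\<phi> ` (r `` {v}) = {1..q}"
proof -
  have v: "v \<in> V" "card (r `` {v}) = q" using assms(1) by (auto simp: S_def)
  have sub: "{1..q} \<subseteq> \<phi> ` (r `` {v})" using out_colours v(1) assms(2) by blast
  have le: "card (\<phi> ` (r `` {v})) \<le> q" using card_image_le[OF finite_out, of \<phi> v] v(2) by simp
  show eq: "\<phi> ` (r `` {v}) = {1..q}"
    using card_seteq[OF _ sub] le finite_out by simp
  show "inj_on \<phi> (r `` {v})"
    using eq v(2) by (intro eq_card_imp_inj_on finite_out) simp
qed

lemma in_bij:
  assumes "v \<in> S" "dicol r q (V - {v}) \<phi>"
  shows "inj_on \<phi> (r\<inverse> `` {v})" "\<phi> ` (r\<inverse> `` {v}) = {1..q}"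
  using critical_oriented.out_bij[OF converse_critical] assms S_converse dicol_converse by metis+

text \<open>
  Adjacency in the underlying undirected graph.
\<close>
definition adj :: "'a \<Rightarrow> 'a \<Rightarrow> bool" where
  "adj u v \<longleftrightarrow> (u, v) \<in> r \<or> (v, u) \<in> r"

lemma adj_symp: "symp adj" and adj_irreflp: "irreflp adj"
  using irrefl by (auto simp: adj_def symp_def irreflp_def)

text \<open>
  When the hole is in \<open>S\<close>, it may take over the colour of any neighbour \<open>w\<close>, which becomes the new
  hole: if \<open>w\<close> is an out-neighbour, it is the only one of its colour, so that \<open>v\<close> is a sink of
  its new colour class.
\<close>
lemma move_hole_out:
  assumes "v \<in> S" "dicol r q (V - {v}) \<phi>" "(v, w) \<in> r"
  shows "dicol r q (V - {w}) (\<phi>(v := \<phi> w))"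
proof (rule dicol_colour_sink)
  have "w \<in> V - {v}" using assms(3) arcs_V irrefl by auto
  then show "\<phi> w \<in> {1..q}" using assms(2) by (auto simp: dicol_def)
  show "dicol r q (V - {w} - {v}) \<phi>" using assms(2) by (rule dicol_subset) auto
  fix u assume u: "u \<in> V - {w}" "(v, u) \<in> r"
  show "u \<noteq> v \<and> \<phi> u \<noteq> \<phi> w"
    using u irrefl inj_onD[OF out_bij(1)[OF assms(1,2)], of u w] assms(3) by auto
qed

lemma move_hole:
  assumes "v \<in> S" "dicol r q (V - {v}) \<phi>" "adj v w"
  shows "dicol r q (V - {w}) (\<phi>(v := \<phi> w))"
  using assms move_hole_out critical_oriented.move_hole_out[OF converse_critical, of v \<phi> w]
  by (auto simp: adj_def S_converse dicol_converse)

end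

section \<open>Moving the hole round a cycle\<close>

text \<open>
  The colouring after \<open>t\<close> moves of a hole that starts at \<open>h 0\<close> and visits \<open>h 0, h 1, h 2, ...\<close> in turn.
  Its value at the hole itself is meaningless.
\<close>
primrec rotate_hole :: "(nat \<Rightarrow> 'a) \<Rightarrow> ('a \<Rightarrow> nat) \<Rightarrow> nat \<Rightarrow> 'a \<Rightarrow> nat" where
  "rotate_hole h \<phi> 0 = \<phi>"
| "rotate_hole h \<phi> (Suc t) = (rotate_hole h \<phi> t)(h t := rotate_hole h \<phi> t (h (Suc t)))"

lemma rotate_hole_keep:
  "(\<And>j. j < d \<Longrightarrow> h (s + j) \<noteq> u) \<Longrightarrow> rotate_hole h \<phi> (s + d) u = rotate_hole h \<phi> s u"
proof (induction d)
  case (Suc d)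
  then show ?case using Suc.prems[of d] by (auto simp: rotate_hole.simps(2))
qed simp

declare rotate_hole.simps(2) [simp del]

lemma inj_image_Int_eq:
  assumes "inj_on f N" "inj_on g N" "f ` N = g ` N" "\<And>u. u \<in> N - X \<Longrightarrow> f u = g u"
  shows "f ` (N \<inter> X) = g ` (N \<inter> X)"
proof -
  have "f ` (N \<inter> X) = f ` N - f ` (N - X)"
    using assms(1) by (subst inj_on_image_set_diff[symmetric, of f N]) (auto simp: Diff_Diff_Int)
  also have "f ` (N - X) = g ` (N - X)" using assms(4) by (intro image_cong) auto
  also have "f ` N - g ` (N - X) = g ` (N \<inter> X)"
    using assms(2,3) by (simp, subst inj_on_image_set_diff[symmetric, of g N]) (auto simp: Diff_Diff_Int)
  finally show ?thesis .
qed

text \<open>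
  A chordless cycle of length \<open>n\<close> inside \<open>S\<close>, unrolled to a periodic sequence \<open>h\<close>, and a dicolouring
  \<open>\<phi>\<close> with hole \<open>h 0\<close>.
\<close>
locale hole_cycle = critical_oriented +
  fixes h :: "nat \<Rightarrow> 'a" and n :: nat and \<phi> :: "'a \<Rightarrow> nat"
  assumes n: "n \<ge> 3"
    and h_eq: "h s = h t \<longleftrightarrow> s mod n = t mod n"
    and h_S: "h t \<in> S"
    and h_adj: "adj (h t) (h (Suc t))"
    and h_chordless: "adj (h s) (h t) \<Longrightarrow> s mod n = Suc t mod n \<or> t mod n = Suc s mod n"
    and start: "dicol r q (V - {h 0}) \<phi>"
begin

text \<open>
  At time \<open>t\<close> the colouring is \<open>f t\<close>, the hole is \<open>h t\<close> and \<open>x t\<close> is the colour of the vertex ahead of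
  the hole. That colour is left behind on \<open>h t\<close>.
\<close>
abbreviation "f \<equiv> rotate_hole h \<phi>"
abbreviation "x t \<equiv> f t (h (Suc t))"
abbreviation "fwd t \<equiv> (h t, h (Suc t)) \<in> r"

lemma state: "dicol r q (V - {h t}) (f t)"
proof (induction t)
  case 0
  show ?case using start by simp
next
  case (Suc t)
  show ?case using move_hole[OF h_S Suc.IH h_adj] unfolding rotate_hole.simps(2) .
qed

lemma h_period: "h (t + n) = h t" "h (Suc t + n) = h (Suc t)" "h (Suc (t + n)) = h (Suc t)"
  by (simp_all add: h_eq mod_Suc)

lemma h_neq: "0 < d \<Longrightarrow> d < n \<Longrightarrow> h (t + d) \<noteq> h t"
proof
  assume d: "0 < d" "d < n" and "h (t + d) = h t"
  then have "(t + d) mod n = t mod n" by (simp add: h_eq)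
  then have "n dvd (t + d) - t" by (metis le_add1 mod_eq_dvd_iff_nat)
  then show False using d by (auto dest: dvd_imp_le)
qed

lemma behind: "f (Suc t) (h t) = x t"
  by (simp add: rotate_hole.simps(2))

text \<open>
  The colour \<open>x (Suc t)\<close> stays on \<open>h (Suc t)\<close> until the hole comes round again; hence \<open>x\<close> has
  period \<open>n - 1\<close>.
\<close>
lemma x_period: "x (t + n) = x (Suc t)"
proof -
  define d where "d = n - 2"
  then have d: "n = d + 2" using n by simp
  have hh: "h (Suc (t + n)) = h (Suc t)" by (rule h_period)
  have "f (Suc (Suc t) + d) (h (Suc t)) = f (Suc (Suc t)) (h (Suc t))"
  proof (rule rotate_hole_keep)
    fix j assume "j < d"
    then show "h (Suc (Suc t) + j) \<noteq> h (Suc t)"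
      using h_neq[of "Suc j" "Suc t"] d by simp
  qed
  also have "\<dots> = x (Suc t)" by (rule behind)
  finally show ?thesis using hh d by (simp add: add.commute)
qed

lemma outside: "u \<notin> range h \<Longrightarrow> f t u = \<phi> u"
  using rotate_hole_keep[of t h 0 u \<phi>] by auto

text \<open>
  Let the hole be at \<open>h (Suc t)\<close>, with colour \<open>x t\<close> behind and \<open>x (Suc t)\<close> ahead. One round later
  these colours are \<open>x (Suc t)\<close> and \<open>x (Suc (Suc t))\<close>, while the colours off the cycle have not
  changed. As all \<open>q\<close> colours occur exactly once among the out-neighbours, and exactly once among the
  in-neighbours, the colours that the cycle contributes to either side are the same set at both times.
\<close>
lemma step:
  shows "fwd t = fwd (Suc t) \<Longrightarrow> x t = x (Suc t) \<and> x (Suc t) = x (Suc (Suc t))"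
    and "fwd t \<noteq> fwd (Suc t) \<Longrightarrow> x t \<noteq> x (Suc t) \<and> x (Suc (Suc t)) = x t"
proof -
  let ?g = "h (Suc t)" and ?p = "h t" and ?s = "h (Suc (Suc t))"
  let ?f = "f (Suc t)" and ?f' = "f (Suc t + n)"
  have g': "h (Suc t + n) = ?g" by (rule h_period)
  have st: "dicol r q (V - {?g}) ?f" "dicol r q (V - {?g}) ?f'"
    using state[of "Suc t"] state[of "Suc t + n"] unfolding g' by blast+
  have p: "?f ?p = x t" "?f' ?p = x (Suc t)"
    using behind[of t] behind[of "t + n"] x_period[of t] h_period(1)[of t] by auto
  have "h (Suc (Suc t + n)) = ?s" by (rule h_period)
  then have s: "?f' ?s = x (Suc (Suc t))" using x_period[of "Suc t"] by metis
  have ps: "?p \<noteq> ?s" using h_neq[of 2 t] n by auto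
  have nb: "u \<in> {?p, ?s}" if adj: "adj ?g u" and range: "u \<in> range h" for u
  proof -
    obtain j where j: "u = h j" using range by blast
    then consider "Suc t mod n = Suc j mod n" | "j mod n = Suc (Suc t) mod n"
      using h_chordless adj by blast
    then show ?thesis
    proof cases
      case 1
      then have "j mod n = t mod n"
        by (auto simp: mod_Suc split: if_splits)
      then show ?thesis using j h_eq by blast
    next
      case 2
      then show ?thesis using j h_eq by blast
    qed
  qed
  have adjs: "adj ?g ?p" "adj ?g ?s"
    using h_adj[of t] h_adj[of "Suc t"] adj_symp by (auto dest: sympD)
  have agree: "?f u = ?f' u" if "u \<in> N - range h" for u N
    using that outside[of u "Suc t"] outside[of u "Suc t + n"] by simp
  have "?f ` (r `` {?g} \<inter> range h) = ?f' ` (r `` {?g} \<inter> range h)"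
    using out_bij[OF h_S st(1)] out_bij[OF h_S st(2)] agree by (intro inj_image_Int_eq) auto
  moreover have "?f ` (r\<inverse> `` {?g} \<inter> range h) = ?f' ` (r\<inverse> `` {?g} \<inter> range h)"
    using in_bij[OF h_S st(1)] in_bij[OF h_S st(2)] agree by (intro inj_image_Int_eq) auto
  moreover have "r `` {?g} \<inter> range h = {u \<in> {?p, ?s}. (?g, u) \<in> r}"
    using nb by (auto simp: adj_def)
  moreover have "r\<inverse> `` {?g} \<inter> range h = {u \<in> {?p, ?s}. (u, ?g) \<in> r}"
    using nb by (auto simp: adj_def)
  ultimately have out: "?f ` {u \<in> {?p, ?s}. (?g, u) \<in> r} = ?f' ` {u \<in> {?p, ?s}. (?g, u) \<in> r}"
    and inn: "?f ` {u \<in> {?p, ?s}. (u, ?g) \<in> r} = ?f' ` {u \<in> {?p, ?s}. (u, ?g) \<in> r}"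
    by simp_all
  have Fp: "(?p, ?g) \<in> r \<longleftrightarrow> fwd t" "(?g, ?p) \<in> r \<longleftrightarrow> \<not> fwd t"
    "(?g, ?s) \<in> r \<longleftrightarrow> fwd (Suc t)" "(?s, ?g) \<in> r \<longleftrightarrow> \<not> fwd (Suc t)"
    using adjs antisym by (auto simp: adj_def)
  {
    assume eq: "fwd t = fwd (Suc t)"
    have "{u \<in> {?p, ?s}. (?g, u) \<in> r} = {if fwd t then ?s else ?p}"
      "{u \<in> {?p, ?s}. (u, ?g) \<in> r} = {if fwd t then ?p else ?s}"
      using Fp eq by auto
    then show "x t = x (Suc t) \<and> x (Suc t) = x (Suc (Suc t))"
      using out inn p s by (auto split: if_splits)
  }
  {
    assume neq: "fwd t \<noteq> fwd (Suc t)"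
    have img: "?f ` {?p, ?s} = ?f' ` {?p, ?s}" and inj: "inj_on ?f {?p, ?s}"
    proof -
      have "{u \<in> {?p, ?s}. (?g, u) \<in> r} = {?p, ?s} \<or> {u \<in> {?p, ?s}. (u, ?g) \<in> r} = {?p, ?s}"
        using Fp neq by auto
      then show "?f ` {?p, ?s} = ?f' ` {?p, ?s}"
      proof
        assume "{u \<in> {?p, ?s}. (?g, u) \<in> r} = {?p, ?s}"
        from out[unfolded this] show ?thesis .
      next
        assume "{u \<in> {?p, ?s}. (u, ?g) \<in> r} = {?p, ?s}"
        from inn[unfolded this] show ?thesis .
      qed
      have "{?p, ?s} \<subseteq> r `` {?g} \<or> {?p, ?s} \<subseteq> r\<inverse> `` {?g}" using Fp neq by auto
      then show "inj_on ?f {?p, ?s}"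
        using inj_on_subset[OF out_bij(1)[OF h_S st(1)]] inj_on_subset[OF in_bij(1)[OF h_S st(1)]]
        by blast
    qed
    have "?f ?p \<noteq> ?f ?s" using inj ps by (auto dest: inj_onD)
    then have "x t \<noteq> x (Suc t)" unfolding p(1) .
    moreover have "{x t, x (Suc t)} = {x (Suc t), x (Suc (Suc t))}"
      using img unfolding image_insert image_empty p s .
    ultimately show "x t \<noteq> x (Suc t) \<and> x (Suc (Suc t)) = x t"
      by (auto simp: doubleton_eq_iff)
  }
qed

lemma fwd_mult: "fwd (t * n) = fwd 0" "fwd (Suc (t * n)) = fwd (Suc 0)"
proof -
  have "h (t * n) = h 0" "h (Suc (t * n)) = h (Suc 0)" "h (Suc (Suc (t * n))) = h (Suc (Suc 0))"
    unfolding h_eq using n by (simp_all add: mod_Suc)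
  then show "fwd (t * n) = fwd 0" "fwd (Suc (t * n)) = fwd (Suc 0)" by simp_all
qed

text \<open>
  By the two cases of lemma \<open>step\<close>, \<open>x t = x (Suc t)\<close> if and only if the cycle runs straight
  through \<open>h (Suc t)\<close>, and then it runs straight through the next vertex as well. So either the
  cycle is directed, or its arcs alternate in direction; in the latter case \<open>n\<close> is even, but the
  colours alternate with the odd period \<open>n - 1\<close>, which is absurd.
\<close>
lemma fwd_x_constant: "fwd t = fwd 0 \<and> x t = x 0"
proof -
  have later: "fwd (t + d) = fwd (Suc (t + d))" if "fwd t = fwd (Suc t)" for t d
  proof (induction d)
    case (Suc d)
    then show ?case using step[of "t + d"] step(2)[of "Suc (t + d)"] by auto
  qed (use that in simp)
  have "fwd 0 = fwd (Suc 0)"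
  proof (rule ccontr)
    assume ne: "fwd 0 \<noteq> fwd (Suc 0)"
    have alt: "fwd t \<noteq> fwd (Suc t)" for t
    proof
      assume "fwd t = fwd (Suc t)"
      moreover have "t * 1 \<le> t * n" using n by (intro mult_le_mono2) simp
      then obtain d where "t * n = t + d" by (auto simp: le_iff_add)
      ultimately show False using later[of t d] fwd_mult[of t] ne by metis
    qed
    have F: "fwd t = (even t = fwd 0)" for t
    proof (induction t)
      case (Suc t)
      then show ?case using alt[of t] by auto
    qed simp
    have X: "x t = (if even t then x 0 else x 1)" for t
    proof (induction t rule: induct_nat_012)
      case (ge2 t)
      then show ?case using step(2)[OF alt[of t]] by simp
    qed simp_all
    have "even n" using F[of "1 * n"] fwd_mult[of 1] by auto
    moreover have "x (0 + n) = x (Suc 0)" by (rule x_period)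
    ultimately have "x 0 = x 1" using X[of n] by simp
    then show False using step(2)[OF ne] by simp
  qed
  then have all: "fwd t = fwd (Suc t)" for t using later[of 0 t] by simp
  then have "fwd t = fwd 0" by (induction t) auto
  moreover have "x t = x 0"
  proof (induction t)
    case (Suc t)
    then show ?case using step(1)[OF all[of t]] by simp
  qed simp
  ultimately show ?thesis by blast
qed

lemma colour_constant:
  assumes "u \<in> range h" "u \<noteq> h 0"
  shows "\<phi> u = \<phi> (h 1)"
proof -
  obtain s where "u = h s" using assms(1) by blast
  then have us: "u = h (s mod n)" "s mod n < n" using n by (simp_all add: h_eq)
  then obtain i where i: "s mod n = Suc i" using assms(2) by (cases "s mod n") auto
  have "f (0 + i) u = f 0 u"
  proof (rule rotate_hole_keep)
    fix j assume "j < i"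
    then show "h (0 + j) \<noteq> u" using us i by (auto simp: h_eq)
  qed
  then have "\<phi> u = x i" using us i by simp
  then show ?thesis using fwd_x_constant[of i] by simp
qed

end

section \<open>Minimum-degree vertices induce a cactus\<close>

context critical_oriented
begin

text \<open>
  The outcome of the rotation argument at the first three vertices of the cycle, with the hole at the
  first; the sequel needs no more than that.
\<close>
lemma chordless_cycle_directed_monochromatic:
  assumes cyc: "ucycle adj S (a # b # c # ys)" and chl: "chordless adj (a # b # c # ys)"
    and col: "dicol r q (V - {a}) \<phi>"
  shows "\<phi> c = \<phi> b" "(a, b) \<in> r \<longleftrightarrow> (b, c) \<in> r"
proof -
  define xs where "xs = a # b # c # ys"
  define n where "n = length xs"
  define h where "h = (\<lambda>t. xs ! (t mod n))"
  have n: "n \<ge> 3" by (simp add: n_def xs_def)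
  have dist: "distinct xs" and sub: "set xs \<subseteq> S" using cyc by (auto simp: ucycle_def xs_def)
  have less: "t mod n < n" for t using n by simp
  interpret hole_cycle r V q h n \<phi>
  proof
    show "n \<ge> 3" by (rule n)
    show "h s = h t \<longleftrightarrow> s mod n = t mod n" for s t
      using dist less by (simp add: h_def n_def nth_eq_iff_index_eq)
    show "h t \<in> S" for t
      using sub less[of t] nth_mem[of "t mod n" xs] by (auto simp: h_def n_def)
    show "adj (h t) (h (Suc t))" for t
      using ucycle_nth[OF cyc] by (simp add: h_def n_def xs_def)
    have "\<forall>s<n. \<forall>t<n. adj (xs ! s) (xs ! t) \<longrightarrow> s = Suc t mod n \<or> t = Suc s mod n"
      using chl unfolding chordless_def by (simp only: xs_def n_def)
    from this[rule_format, OF less less]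
    show "adj (h s) (h t) \<Longrightarrow> s mod n = Suc t mod n \<or> t mod n = Suc s mod n" for s t
      unfolding h_def mod_Suc_eq .
    show "dicol r q (V - {h 0}) \<phi>"
      using col n by (simp add: h_def xs_def)
  qed
  have h: "h 0 = a" "h 1 = b" "h 2 = c" "h (Suc 0) = b" "h (Suc (Suc 0)) = c"
    using n by (simp_all add: h_def xs_def)
  have "a \<noteq> c" using dist by (simp add: xs_def)
  then show "\<phi> c = \<phi> b" using colour_constant[of c] h by (metis rangeI)
  show "(a, b) \<in> r \<longleftrightarrow> (b, c) \<in> r" using fwd_x_constant[of "Suc 0"] h by simp
qed

text \<open>
  With the hole moved from \<open>a\<close> to \<open>b\<close>, the vertices \<open>c\<close> and \<open>d\<close> have the same colour and are both
  out-neighbours or both in-neighbours of \<open>b\<close>.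
\<close>
lemma chordless_cycle_determined_by_arc:
  assumes c: "ucycle adj S (a # b # c # ys)" "chordless adj (a # b # c # ys)"
    and d: "ucycle adj S (a # b # d # zs)" "chordless adj (a # b # d # zs)"
  shows "c = d"
proof -
  have ab: "a \<in> S" "b \<in> S" "adj a b" "a \<noteq> c" "a \<noteq> d" and bcd: "adj b c" "adj b d"
    using c(1) d(1) by (auto simp: ucycle_def)
  obtain \<phi> where \<phi>: "dicol r q (V - {a}) \<phi>" using col_delete ab(1) by (auto simp: S_def)
  have \<phi>': "dicol r q (V - {b}) (\<phi>(a := \<phi> b))" by (rule move_hole[OF ab(1) \<phi> ab(3)])
  have same: "(\<phi>(a := \<phi> b)) c = (\<phi>(a := \<phi> b)) d"
    using chordless_cycle_directed_monochromatic(1)[OF c \<phi>]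
      chordless_cycle_directed_monochromatic(1)[OF d \<phi>] ab by simp
  have dir: "(b, c) \<in> r \<longleftrightarrow> (b, d) \<in> r"
    using chordless_cycle_directed_monochromatic(2)[OF c \<phi>]
      chordless_cycle_directed_monochromatic(2)[OF d \<phi>] by simp
  show ?thesis
  proof (cases "(b, c) \<in> r")
    case True
    then show ?thesis
      using inj_onD[OF out_bij(1)[OF ab(2) \<phi>'] same] dir by simp
  next
    case False
    then show ?thesis
      using inj_onD[OF in_bij(1)[OF ab(2) \<phi>'] same] dir bcd by (simp add: adj_def)
  qed
qed

lemma card_arcs_S:
  assumes "S \<noteq> {}"
  shows "2 * card (r \<inter> S \<times> S) + 3 \<le> 3 * card S"
proof (rule cactus_card_arcs[where E = adj])
  show "finite S" using finite_V by (auto simp: S_def)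
  show "adj = (\<lambda>u v. (u, v) \<in> r \<or> (v, u) \<in> r)" by (auto simp: adj_def fun_eq_iff)
  show "c = d" if "ucycle adj S (a # b # c # ys)" "ucycle adj S (a # b # d # zs)" for a b c d ys zs
    using ucycle_determined_by_edge[OF adj_symp adj_irreflp chordless_cycle_determined_by_arc that] .
qed (use assms antisym in auto)

text \<open>
  Degree sums over \<open>A\<close> count the arcs that leave, or enter, a vertex of \<open>A\<close>.
\<close>
lemma sum_out_degrees:
  assumes "finite A"
  shows "(\<Sum>v\<in>A. card (r `` {v})) = card (r \<inter> A \<times> UNIV)"
proof -
  have "r \<inter> A \<times> UNIV = Sigma A (\<lambda>v. r `` {v})" by auto
  then show ?thesis using assms finite_out by simp
qed

lemma sum_in_degrees:
  assumes "finite A"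
  shows "(\<Sum>v\<in>A. card (r\<inverse> `` {v})) = card (r \<inter> UNIV \<times> A)"
proof -
  have "(r \<inter> UNIV \<times> A)\<inverse> = r\<inverse> \<inter> A \<times> UNIV" by auto
  then have "card (r \<inter> UNIV \<times> A) = card (r\<inverse> \<inter> A \<times> UNIV)"
    by (metis card_inverse)
  then show ?thesis
    using critical_oriented.sum_out_degrees[OF converse_critical assms] by simp
qed

lemma card_arcs_degree_sum: "(2 * q + 1) * card V \<le> 2 * card r + card S"
proof -
  have "S \<subseteq> V" by (auto simp: S_def)
  have r: "r \<inter> V \<times> UNIV = r" "r \<inter> UNIV \<times> V = r" using arcs_V by auto
  have "(2 * q + 1) * card V = (\<Sum>v\<in>V. 2 * q + 1)" by simp
  also have "\<dots> \<le> (\<Sum>v\<in>V. card (r `` {v}) + card (r\<inverse> `` {v}) + (if v \<in> S then 1 else 0))"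
  proof (rule sum_mono)
    fix v assume "v \<in> V"
    then show "2 * q + 1 \<le> card (r `` {v}) + card (r\<inverse> `` {v}) + (if v \<in> S then 1 else 0)"
      using out_degree_ge[of v] in_degree_ge[of v] by (auto simp: S_def)
  qed
  also have "\<dots> = 2 * card r + card S"
    using sum_out_degrees[OF finite_V] sum_in_degrees[OF finite_V] finite_V \<open>S \<subseteq> V\<close>
    by (simp add: sum.distrib r sum.If_cases Int_absorb1)
  finally show ?thesis .
qed

lemma card_arcs_meeting_S: "2 * q * card S \<le> card r + card (r \<inter> S \<times> S)"
proof -
  have fin: "finite S" using finite_V by (auto simp: S_def)
  have "2 * q * card S = (\<Sum>v\<in>S. card (r `` {v}) + card (r\<inverse> `` {v}))"
    by (simp add: S_def)
  also have "\<dots> = card (r \<inter> S \<times> UNIV) + card (r \<inter> UNIV \<times> S)"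
    using sum_out_degrees[OF fin] sum_in_degrees[OF fin] by (simp add: sum.distrib)
  also have "\<dots> = card (r \<inter> S \<times> UNIV \<union> r \<inter> UNIV \<times> S) + card ((r \<inter> S \<times> UNIV) \<inter> (r \<inter> UNIV \<times> S))"
    using finite_r by (intro card_Un_Int) auto
  also have "(r \<inter> S \<times> UNIV) \<inter> (r \<inter> UNIV \<times> S) = r \<inter> S \<times> S" by auto
  also have "card (r \<inter> S \<times> UNIV \<union> r \<inter> UNIV \<times> S) \<le> card r"
    using finite_r by (intro card_mono) auto
  finally show ?thesis by simp
qed

lemma V_nonempty: "V \<noteq> {}"
proof
  assume "V = {}"
  then have "dicol r q V (\<lambda>_. 0)" by (simp add: dicol_def mono_arcs_def acyclic_def)
  then show False using no_col by blast
qed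

end

section \<open>Dicritical oriented graphs\<close>

lemma (in wf_digraph) acyclic_digraph_iff: "acyclic_digraph G \<longleftrightarrow> acyclic (arcs_ends G)"
proof
  assume "acyclic_digraph G"
  show "acyclic (arcs_ends G)"
    unfolding acyclic_def
  proof clarify
    fix x assume "x \<rightarrow>\<^sup>+\<^bsub>G\<^esub> x"
    then obtain p where "awalk x p x" "p \<noteq> []" unfolding reachable1_awalk by blast
    then have "closed_w p" by (auto simp: closed_w_def)
    then show False using closed_w_imp_cycle \<open>acyclic_digraph G\<close> by (auto simp: acyclic_digraph_def)
  qed
next
  assume ac: "acyclic (arcs_ends G)"
  show "acyclic_digraph G"
    unfolding acyclic_digraph_def
  proof
    assume "\<exists>p. cycle p"
    then obtain u p where "awalk u p u" "p \<noteq> []" by (auto simp: cycle_def)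
    then have "u \<rightarrow>\<^sup>+\<^bsub>G\<^esub> u" unfolding reachable1_awalk by blast
    then show False using ac by (simp add: acyclic_def)
  qed
qed

lemma arcs_ends_induce_subgraph:
  "arcs_ends (G \<restriction> A) = {(u, w) \<in> arcs_ends G. u \<in> A \<and> w \<in> A}"
  by (auto simp: arcs_ends_conv)

text \<open>
  A directed walk along monochromatic arcs stays inside the colour class where it starts.
\<close>
lemma mono_arcs_trancl_class:
  assumes "(x, y) \<in> (mono_arcs r A \<phi>)\<^sup>+"
  shows "\<phi> y = \<phi> x \<and> (x, y) \<in> {(u, w) \<in> r. u \<in> {v\<in>A. \<phi> v = \<phi> x} \<and> w \<in> {v\<in>A. \<phi> v = \<phi> x}}\<^sup>+"
  using assms
proof (induction rule: trancl_induct)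
  case (base y)
  then show ?case by (auto simp: mono_arcs_def)
next
  case (step y z)
  then show ?case by (auto simp: mono_arcs_def intro: trancl_into_trancl)
qed

lemma (in wf_digraph) dicolouring_iff:
  "dicolouring G q c \<longleftrightarrow> dicol (arcs_ends G) q (verts G) c"
proof -
  let ?cls = "\<lambda>i. {(u, w) \<in> arcs_ends G. u \<in> {v\<in>verts G. c v = i} \<and> w \<in> {v\<in>verts G. c v = i}}"
  have cls: "acyclic_digraph (G \<restriction> {v\<in>verts G. c v = i}) \<longleftrightarrow> acyclic (?cls i)" for i
    using wf_digraph.acyclic_digraph_iff[OF wellformed_induce_subgraph]
    by (simp add: arcs_ends_induce_subgraph)
  show ?thesis
  proof
    assume L: "dicolouring G q c"
    have "acyclic (mono_arcs (arcs_ends G) (verts G) c)"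
      unfolding acyclic_def
    proof clarify
      fix x assume x: "(x, x) \<in> (mono_arcs (arcs_ends G) (verts G) c)\<^sup>+"
      obtain y where "(x, y) \<in> mono_arcs (arcs_ends G) (verts G) c" using tranclD[OF x] by blast
      then have "c x \<in> {1..q}" using L by (auto simp: mono_arcs_def dicolouring_def)
      then have "acyclic (?cls (c x))" using L cls unfolding dicolouring_def by blast
      then show False using mono_arcs_trancl_class[OF x] by (simp add: acyclic_def)
    qed
    then show "dicol (arcs_ends G) q (verts G) c"
      using L by (auto simp: dicol_def dicolouring_def)
  next
    assume R: "dicol (arcs_ends G) q (verts G) c"
    have "acyclic (?cls i)" for i
    proof (rule acyclic_subset)
      show "acyclic (mono_arcs (arcs_ends G) (verts G) c)" using R by (simp add: dicol_def)
    qed (auto simp: mono_arcs_def)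
    then show "dicolouring G q c"
      using R cls by (auto simp: dicol_def dicolouring_def)
  qed
qed

text \<open>
  An injective colouring has no monochromatic arcs in a loopless digraph.
\<close>
lemma (in digraph) dicolouring_exists: "\<exists>k c. dicolouring G k c"
proof -
  obtain g :: "'a \<Rightarrow> nat" and n where g: "g ` verts G = {i. i < n}" "inj_on g (verts G)"
    using finite_imp_inj_to_nat_seg[OF finite_verts] by blast
  have "mono_arcs (arcs_ends G) (verts G) (Suc \<circ> g) = {}"
    using g(2) adj_not_same by (auto simp: mono_arcs_def dest: inj_onD)
  then have "dicol (arcs_ends G) n (verts G) (Suc \<circ> g)"
  proof -
    have "g v < n" if "v \<in> verts G" for v using g(1) that by blast
    then have "(Suc \<circ> g) ` verts G \<subseteq> {1..n}" by (auto simp: Suc_le_eq)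
    then show ?thesis using \<open>mono_arcs _ _ _ = {}\<close> by (simp add: dicol_def acyclic_def)
  qed
  then show ?thesis using dicolouring_iff by blast
qed

lemma dicolouring_dichromatic_number:
  assumes "digraph G"
  shows "\<exists>c. dicolouring G (dichromatic_number G) c"
  unfolding dichromatic_number_def
  using LeastI_ex[OF digraph.dicolouring_exists[OF assms]] .

lemma dicritical_critical_oriented:
  assumes "k \<ge> 1" "oriented_graph D" "dicritical k D"
  shows "critical_oriented (arcs_ends D) (verts D) (k - 1)"
proof -
  interpret oriented_graph D by (rule assms(2))
  show ?thesis
  proof
    show "arcs_ends D \<subseteq> verts D \<times> verts D" using adj_in_verts by auto
    show "(v, u) \<notin> arcs_ends D" if "(u, v) \<in> arcs_ends D" for u v
      using no_opposite_arcs that .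
    show "\<not> dicol (arcs_ends D) (k - 1) (verts D) \<phi>" for \<phi>
    proof
      assume "dicol (arcs_ends D) (k - 1) (verts D) \<phi>"
      then have "\<exists>c. dicolouring D (k - 1) c" using dicolouring_iff by blast
      then have "dichromatic_number D \<le> k - 1" unfolding dichromatic_number_def by (rule Least_le)
      then show False using assms(1,3) by (simp add: dicritical_def)
    qed
    fix v assume v: "v \<in> verts D"
    let ?H = "D \<restriction> (verts D - {v})"
    have sub: "subgraph ?H D" by (intro induced_imp_subgraph induced_induce) auto
    then have "proper_subgraph ?H D" using v by (auto simp: proper_subgraph_def)
    then have less: "dichromatic_number ?H < k" using assms(3) by (simp add: dicritical_def)
    have H: "digraph ?H" using sub by (rule digraph_subgraph)
    then interpret H: digraph ?H .
    obtain c where "dicolouring ?H (dichromatic_number ?H) c"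
      using dicolouring_dichromatic_number[OF H] by blast
    then have "dicol (arcs_ends ?H) (dichromatic_number ?H) (verts D - {v}) c"
      using H.dicolouring_iff by simp
    moreover have "mono_arcs (arcs_ends ?H) (verts D - {v}) c = mono_arcs (arcs_ends D) (verts D - {v}) c"
      by (auto simp: mono_arcs_def arcs_ends_induce_subgraph)
    ultimately have "dicol (arcs_ends D) (k - 1) (verts D - {v}) c"
      using less by (fastforce simp: dicol_def)
    then show "\<exists>\<phi>. dicol (arcs_ends D) (k - 1) (verts D - {v}) \<phi>" by blast
  qed simp
qed

text \<open>
  Elimination of \<open>s\<close> and \<open>t\<close>. If \<open>s = 0\<close> the degree bound alone is enough, and \<open>n \<ge> 1\<close> pays for the
  additive constant.
\<close>
lemma arc_bound_arithmetic:
  fixes k m n s t :: nat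
  assumes k: "k \<ge> 3" and n: "n \<ge> 1"
    and degs: "(2 * (k - 1) + 1) * n \<le> 2 * m + s"
    and meet: "2 * (k - 1) * s \<le> m + t"
    and cactus: "s \<noteq> 0 \<Longrightarrow> 2 * t + 3 \<le> 3 * s"
  shows "real m \<ge> (real k - 3 / 4 - 1 / (4 * real k - 6)) * real n + 3 / (4 * (2 * real k - 3))"
proof -
  define K where "K = real k"
  have K: "K \<ge> 3" using k by (simp add: K_def)
  have "real ((2 * (k - 1) + 1) * n) \<le> real (2 * m + s)" using degs by (simp only: of_nat_le_iff)
  moreover have k1: "real (k - 1) = K - 1" using k by (simp add: K_def)
  moreover have "real ((2 * (k - 1) + 1) * n) = (2 * K - 1) * real n"
    unfolding of_nat_mult of_nat_add of_nat_numeral of_nat_1 k1 by (simp add: algebra_simps)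
  ultimately have degs': "(2 * K - 1) * real n \<le> 2 * real m + real s" by simp
  have "real (2 * (k - 1) * s) \<le> real (m + t)" using meet by (simp only: of_nat_le_iff)
  then have meet': "2 * (K - 1) * real s \<le> real m + real t"
    unfolding of_nat_mult of_nat_add of_nat_numeral k1 .
  have main: "(4 * K - 7) * (2 * K - 1) * real n + 3 \<le> (8 * K - 12) * real m"
  proof (cases "s = 0")
    case True
    have "(4 * K - 6) * ((2 * K - 1) * real n) \<le> (4 * K - 6) * (2 * real m)"
      using degs' True K by (intro mult_left_mono) auto
    moreover have "3 * 1 \<le> (2 * K - 1) * real n"
      using K n by (intro mult_mono) auto
    ultimately show ?thesis by (simp add: algebra_simps)
  next
    case False
    have "real (2 * t + 3) \<le> real (3 * s)" using cactus[OF False] by (simp only: of_nat_le_iff)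
    then have "(4 * K - 7) * real s + 3 \<le> 2 * real m"
      using meet' by (simp add: algebra_simps)
    moreover have "(4 * K - 7) * ((2 * K - 1) * real n) \<le> (4 * K - 7) * (2 * real m + real s)"
      using degs' K by (intro mult_left_mono) auto
    ultimately show ?thesis by (simp add: algebra_simps)
  qed
  have "(K - 3 / 4 - 1 / (4 * K - 6)) * real n + 3 / (4 * (2 * K - 3))
      = ((4 * K - 7) * (2 * K - 1) * real n + 3) / (8 * K - 12)"
    using K by (simp add: divide_simps) (simp add: algebra_simps)
  also have "\<dots> \<le> real m" using main K by (simp add: divide_simps mult.commute)
  finally show ?thesis by (simp add: K_def)
qed

theorem theorem5p2:
  fixes D :: "('a, 'b) pre_digraph" and k :: nat
  assumes "k \<ge> 3"
    and "oriented_graph D"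
    and "dicritical k D"
  shows "real (card (arcs D)) \<ge>
    (real k - 3 / 4 - 1 / (4 * real k - 6)) * real (card (verts D)) + 3 / (4 * (2 * real k - 3))"
proof -
  interpret oriented_graph D by (rule assms(2))
  interpret critical_oriented "arcs_ends D" "verts D" "k - 1"
    using assms by (intro dicritical_critical_oriented) auto
  have "card (arcs_ends D) = card (arcs D)"
    unfolding arcs_ends_def by (rule card_image[OF inj_on_arc_to_ends])
  moreover have "card S \<noteq> 0 \<Longrightarrow> 2 * card (arcs_ends D \<inter> S \<times> S) + 3 \<le> 3 * card S"
    using card_arcs_S by fastforce
  moreover have "card (verts D) \<ge> 1"
    using V_nonempty by (simp add: Suc_leI card_gt_0_iff)
  ultimately show ?thesis
    using arc_bound_arithmetic[OF assms(1) _ card_arcs_degree_sum card_arcs_meeting_S] by simp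
qed

end
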